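(* Let $D=\{z\in\mathbb{C} : |z|<1\}$ be the open unit disc, and let $f:\mathbb{C}\to\mathbb{C}$ be the quartic polynomial $f(z)=\frac{1}{6}z^{4}+\frac{2}{3}z^{3}+\frac{7}{6}z^{2}+z$. Then $f$ is univalent in $D$; that is, for all $z,w\in D$, if $f(z)=f(w)$ then $z=w$.
   Context: A function is called univalent if it is injective in the open unit disc $D=\{z\in\mathbb{C} : |z|<1\}$. *)

theory Defs
  imports "HOL-Analysis.Analysis"
begin

definition unit_disc :: "complex set"
  where "unit_disc = {z. norm z < 1}"

definition univalent :: "(complex \<Rightarrow> complex) \<Rightarrow> bool"
  where "univalent f \<longleftrightarrow> inj_on f unit_disc"

end

theory Submission
  imports Defs
begin

text \<open>
  Shifting the disc to \<open>u = z + 1\<close> turns the quartic into \<open>6 f(z) = u\<^sup>4 + u\<^sup>2 - 2\<close>, a quadratic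
  polynomial in \<open>u\<^sup>2\<close>. Hence, with \<open>u = z + 1\<close> and \<open>v = w + 1\<close>,
  \<open>6 (f(z) - f(w)) = (u - v) (u + v) (u\<^sup>2 + v\<^sup>2 + 1)\<close>.
  The last two factors do not vanish when \<open>z\<close> and \<open>w\<close> lie in the disc: \<open>u + v\<close> has positive real
  part because \<open>u\<close> and \<open>v\<close> do, and \<open>u\<^sup>2 + v\<^sup>2 + 1\<close> has positive real part because squaring maps the
  disc with centre 1 and radius 1 onto the inside of a cardioid, which lies to the right of the
  line \<open>Re = -1/2\<close>.
\<close>

text \<open>
  With \<open>u = a + i b\<close>, membership in the disc reads \<open>b\<^sup>2 < 2 a - a\<^sup>2\<close>, so that
  \<open>Re (u\<^sup>2) = a\<^sup>2 - b\<^sup>2\<close> exceeds \<open>2 a\<^sup>2 - 2 a = 2 (a - 1/2)\<^sup>2 - 1/2\<close>.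
\<close>
lemma Re_square_shifted_disc:
  fixes z :: complex
  assumes "norm z < 1"
  shows "Re ((z + 1)\<^sup>2) > - 1 / 2"
proof -
  have "(Re z)\<^sup>2 + (Im z)\<^sup>2 < 1"
    using assms by (simp add: cmod_def)
  moreover have "0 \<le> 2 * (Re z + 1 / 2)\<^sup>2"
    by simp
  ultimately show ?thesis
    by (simp add: power2_eq_square algebra_simps)
qed

lemma Re_shifted_disc_pos:
  fixes z :: complex
  assumes "norm z < 1"
  shows "Re (z + 1) > 0"
  using assms abs_Re_le_cmod[of z] by simp

theorem proposition1:
  fixes f :: "complex \<Rightarrow> complex"
  assumes "\<And>z. f z = 1 / 6 * z ^ 4 + 2 / 3 * z ^ 3 + 7 / 6 * z ^ 2 + z"
  shows "univalent f"
  unfolding univalent_def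
proof (rule inj_onI)
  fix z w
  assume "z \<in> unit_disc" "w \<in> unit_disc" and eq: "f z = f w"
  then have z: "norm z < 1" and w: "norm w < 1"
    by (simp_all add: unit_disc_def)
  have "(z - w) * ((z + 1) + (w + 1)) * ((z + 1)\<^sup>2 + (w + 1)\<^sup>2 + 1) = 6 * (f z - f w)"
    unfolding assms by (simp add: field_simps power2_eq_square power3_eq_cube power4_eq_xxxx)
  also have "\<dots> = 0"
    using eq by simp
  finally have "(z - w) * ((z + 1) + (w + 1)) * ((z + 1)\<^sup>2 + (w + 1)\<^sup>2 + 1) = 0" .
  moreover have "Re ((z + 1) + (w + 1)) > 0"
    using Re_shifted_disc_pos[OF z] Re_shifted_disc_pos[OF w] by simp
  then have "(z + 1) + (w + 1) \<noteq> 0"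
    by (metis less_irrefl zero_complex.sel(1))
  moreover have "Re ((z + 1)\<^sup>2 + (w + 1)\<^sup>2 + 1) > 0"
    using Re_square_shifted_disc[OF z] Re_square_shifted_disc[OF w]
    unfolding plus_complex.sel one_complex.sel by linarith
  then have "(z + 1)\<^sup>2 + (w + 1)\<^sup>2 + 1 \<noteq> 0"
    by (metis less_irrefl zero_complex.sel(1))
  ultimately show "z = w"
    by simp
qed

end
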